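(* Let $n\ge 1$, let $\mathbf{k}=(k_1,\ldots,k_n)$ be a tuple of positive integers and $K=k_1+\cdots+k_n$. Then: (1) $B_{\mathbf{k}}(m)$ and $b_{\mathbf{k}}(m)$ are polynomials in $m$ of degree $K$, both with leading coefficient $|\mathcal{SP}_{\mathbf{k}}|/K!$; moreover $B_{\mathbf{k}}(0)=B_{\mathbf{k}}(-1)=\cdots=B_{\mathbf{k}}(-K+n)=0$ and $B_{\mathbf{k}}(m)=(-1)^K b_{\mathbf{k}}(-m)$ (as polynomials). (2) If $k_n>1$, then for every positive integer $m$, $$B_{\mathbf{k}}(m)=\sum_{i=0}^{m} i\,B_{\mathbf{k}\setminus k_n}(i)\binom{k_n+m-i-2}{k_n-2},\qquad b_{\mathbf{k}}(m)=\sum_{i=0}^{m-1} i\,b_{\mathbf{k}\setminus k_n}(i)\binom{m-i-1}{k_n-2},$$ where $\mathbf{k}\setminus k_n=(k_1,\ldots,k_{n-1})$. (3) $B_{\emptyset}(m)=1$, $B_{\mathbf{k}}(0)=0$, and for every positive integer $m$: $B_{\mathbf{k}}(m)=B_{\mathbf{k}}(m-1)+B_{\mathbf{k}'}(m)$ if $k_n>1$, and $B_{\mathbf{k}}(m)=m\,B_{\mathbf{k}'}(m)$ if $k_n=1$. (4) $b_{\emptyset}(m)=1$, $b_{\mathbf{k}}(0)=0$, and for every positive integer $m$: $b_{\mathbf{k}}(m)=b_{\mathbf{k}}(m-1)+b_{\mathbf{k}'}(m-1)$ if $k_n>1$, and $b_{\mathbf{k}}(m)=m\,b_{\mathbf{k}'}(m)$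 if $k_n=1$. Here $\mathbf{k}'=(k_1,\ldots,k_{n-1},k_n-1)$, where a tuple whose last entry is $0$ is identified with the tuple obtained by deleting that entry.
   Context: For a tuple $\mathbf{k}=(k_1,\ldots,k_n)$ of positive integers, $K=k_1+\cdots+k_n$, consider the multiset $\{1^{k_1},\ldots,n^{k_n}\}$ ($k_i$ copies of $i$). A Stirling permutation of it is a word $\sigma=\sigma(1)\cdots\sigma(K)$ containing each $i$ exactly $k_i$ times such that whenever $\sigma(i)=\sigma(j)$ and $i<s<j$, one has $\sigma(s)\ge\sigma(i)$. $\mathcal{SP}_{\mathbf{k}}$ denotes the set of Stirling permutations. An index $i\in\{1,\ldots,K\}$ is a descent of $\sigma$ if either $i<K$ and $\sigma(i)>\sigma(i+1)$, or $i=K$. $A_{\mathbf{k},i}$ is the number of $\sigma\in\mathcal{SP}_{\mathbf{k}}$ with exactly $i$ descents. Define the formal power series $$G_{\mathbf{k}}(x)=\frac{\sum_{i=1}^{n}A_{\mathbf{k},i}x^i}{(1-x)^{K+1}}=\sum_{m\ge0}B_{\mathbf{k}}(m)x^m,\qquad g_{\mathbf{k}}(x)=\frac{\sum_{i=K-n+1}^{K}A_{\mathbf{k},K+1-i}x^i}{(1-x)^{K+1}}=\sum_{m\ge0}b_{\mathbf{k}}(m)x^m.$$ For the empty tuple, $B_\emptyset(m)=b_\emptyset(m)=1$ by convention. *)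

theory Defs
  imports
    Complex_Main
    "HOL-Library.Multiset"
    "HOL-Computational_Algebra.Polynomial"
    "HOL-Computational_Algebra.Formal_Power_Series"
begin

text \<open>A tuple \<open>(k\<^sub>1, \<dots>, k\<^sub>n)\<close> is a list \<open>k\<close> with \<open>k\<^sub>i = k ! (i - 1)\<close>; words are lists, with positions
  counted from 0.\<close>

definition tuple_mset :: "nat list \<Rightarrow> nat multiset" where
  "tuple_mset k = (\<Sum>i<length k. replicate_mset (k ! i) (Suc i))"

definition stirling_perms :: "nat list \<Rightarrow> nat list set" where
  "stirling_perms k = {\<sigma>. mset \<sigma> = tuple_mset k \<and>
     (\<forall>i s j. i < s \<and> s < j \<and> j < length \<sigma> \<and> \<sigma> ! i = \<sigma> ! j \<longrightarrow> \<sigma> ! s \<ge> \<sigma> ! i)}"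

text \<open>The last position of a nonempty word always counts as a descent.\<close>

definition descents :: "nat list \<Rightarrow> nat set" where
  "descents \<sigma> = {i. i < length \<sigma> \<and>
     ((Suc i < length \<sigma> \<and> \<sigma> ! i > \<sigma> ! Suc i) \<or> Suc i = length \<sigma>)}"

definition stirling_A :: "nat list \<Rightarrow> nat \<Rightarrow> nat" where
  "stirling_A k i = card {\<sigma> \<in> stirling_perms k. card (descents \<sigma>) = i}"

definition G_series :: "nat list \<Rightarrow> rat fps" where
  "G_series k =
     (\<Sum>i = 1..length k. of_nat (stirling_A k i) * fps_X ^ i) / (1 - fps_X) ^ (sum_list k + 1)"

definition g_series :: "nat list \<Rightarrow> rat fps" where
  "g_series k =
     (\<Sum>i = sum_list k - length k + 1..sum_list k. of_nat (stirling_A k (sum_list k + 1 - i)) * fps_X ^ i)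
       / (1 - fps_X) ^ (sum_list k + 1)"

text \<open>For the empty tuple the value 1 is a convention: the series above would vanish.\<close>

definition stirling_B :: "nat list \<Rightarrow> nat \<Rightarrow> rat" where
  "stirling_B k m = (if k = [] then 1 else fps_nth (G_series k) m)"

definition stirling_b :: "nat list \<Rightarrow> nat \<Rightarrow> rat" where
  "stirling_b k m = (if k = [] then 1 else fps_nth (g_series k) m)"

text \<open>The tuple \<open>k'\<close>, whose last entry is dropped when it becomes 0.\<close>

definition dec_last :: "nat list \<Rightarrow> nat list" where
  "dec_last k = (if last k = 1 then butlast k else butlast k @ [last k - 1])"

end

theory Submission imports Defs "HOL-Library.Sublist" begin

text \<open>In a Stirling permutation all copies of the largest letter are adjacent, so the Stirling
  permutations of \<open>(k\<^sub>1, \<dots>, k\<^sub>n)\<close> arise from those of \<open>(k\<^sub>1, \<dots>, k\<^sub>n\<^sub>-\<^sub>1)\<close> by inserting one block at any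
  position. Inserting it right after a descent keeps the number of descents, any other position
  raises it by one. Writing \<open>B(x)\<close> as the sum of the generalised binomial coefficients
  \<open>(x - des + K) gchoose K\<close> over all Stirling permutations, the recurrences for \<open>B\<close> become Pascal's rule
  (\<open>k\<^sub>n > 1\<close>) and the absorption identity (\<open>k\<^sub>n = 1\<close>), valid for every rational \<open>x\<close>. Negating the upper
  index gives \<open>b(m) = (-1)\<^sup>K B(-m)\<close>, which transports everything to \<open>b\<close>. Part (2) iterates the
  recurrence in \<open>k\<^sub>n\<close>.\<close>

section \<open>Insertion of the largest letter\<close>

text \<open>The Stirling condition as pattern avoidance without indices: it passes to subwords by
  transitivity of \<open>subseq\<close>, in particular to words from which a letter has been
  filtered out.\<close>

definition avoids_valleys :: "nat list \<Rightarrow> bool" where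
  "avoids_valleys w \<longleftrightarrow> (\<forall>x y. y < x \<longrightarrow> \<not> subseq [x, y, x] w)"

lemma subseq_triple_iff:
  "subseq [x, y, z] w \<longleftrightarrow>
     (\<exists>i s j. i < s \<and> s < j \<and> j < length w \<and> w ! i = x \<and> w ! s = y \<and> w ! j = z)"
proof
  assume "subseq [x, y, z] w"
  then obtain a b where w: "w = a @ x # b" and "subseq [y, z] b"
    by (auto dest: list_emb_ConsD)
  then obtain c d where b: "b = c @ y # d" and "subseq [z] d"
    by (auto dest: list_emb_ConsD)
  then obtain e f where d: "d = e @ z # f"
    by (auto dest: list_emb_ConsD)
  show "\<exists>i s j. i < s \<and> s < j \<and> j < length w \<and> w ! i = x \<and> w ! s = y \<and> w ! j = z"
    \<comment> \<open>The positions of the three letters in the decomposition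
      \<open>a @ x # c @ y # e @ z # f\<close> of \<open>w\<close>.\<close>
    by (rule exI[of _ "length a"], rule exI[of _ "Suc (length a + length c)"],
        rule exI[of _ "Suc (Suc (length a + length c + length e))"])
       (auto simp: w b d nth_append)
next
  assume "\<exists>i s j. i < s \<and> s < j \<and> j < length w \<and> w ! i = x \<and> w ! s = y \<and> w ! j = z"
  then obtain i s j where *: "i < s" "s < j" "j < length w" "w ! i = x" "w ! s = y" "w ! j = z"
    by blast
  have "w = take s w @ y # drop (Suc s) w"
    using * id_take_nth_drop[of s w] by simp
  moreover have "x \<in> set (take s w)"
    using * by (auto simp: in_set_conv_nth intro!: exI[of _ i])
  moreover have "z \<in> set (drop (Suc s) w)"
    using * by (auto simp: in_set_conv_nth intro!: exI[of _ "j - Suc s"])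
  ultimately show "subseq [x, y, z] w"
    by (metis append_Cons append_Nil list_emb_append_mono subseq_Cons2 subseq_singleton_left)
qed

lemma stirling_perms_altdef:
  "stirling_perms k = {w. mset w = tuple_mset k \<and> avoids_valleys w}"
  unfolding stirling_perms_def avoids_valleys_def subseq_triple_iff
  by (auto simp: not_less) (metis not_less)+

lemma tuple_mset_Nil [simp]: "tuple_mset [] = {#}"
  by (simp add: tuple_mset_def)

lemma tuple_mset_snoc [simp]:
  "tuple_mset (k @ [a]) = tuple_mset k + replicate_mset a (Suc (length k))"
  by (simp add: tuple_mset_def nth_append)

lemma size_tuple_mset: "size (tuple_mset k) = sum_list k"
  by (induction k rule: rev_induct) auto

lemma set_tuple_mset_le: "x \<in># tuple_mset k \<Longrightarrow> x \<le> length k"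
  by (induction k rule: rev_induct) (auto split: if_splits)

lemma stirling_perms_Nil: "stirling_perms [] = {[]}"
  by (auto simp: stirling_perms_altdef avoids_valleys_def)

lemma finite_stirling_perms: "finite (stirling_perms k)"
proof -
  obtain v where "mset v = tuple_mset k" using ex_mset by blast
  then have "stirling_perms k \<subseteq> {w. mset w = mset v}" by (auto simp: stirling_perms_def)
  then show ?thesis by (rule finite_subset) (rule mset_eq_finite)
qed

lemma length_stirling_perm: "w \<in> stirling_perms k \<Longrightarrow> length w = sum_list k"
  by (metis (mono_tags, lifting) stirling_perms_def mem_Collect_eq size_mset size_tuple_mset)

lemma stirling_perm_letter_le: "w \<in> stirling_perms k \<Longrightarrow> x \<in> set w \<Longrightarrow> x \<le> length k"
  by (metis (mono_tags, lifting) stirling_perms_def mem_Collect_eq set_mset_mset set_tuple_mset_le)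

section \<open>Insertion of a block of equal letters and its inverse\<close>

definition insert_block :: "nat \<Rightarrow> nat \<Rightarrow> nat list \<Rightarrow> nat \<Rightarrow> nat list" where
  "insert_block N a w p = take p w @ replicate a N @ drop p w"

lemma filter_insert_block:
  assumes "N \<notin> set w"
  shows "filter (\<lambda>x. x \<noteq> N) (insert_block N a w p) = w"
proof -
  have "filter (\<lambda>x. x \<noteq> N) (take p w) = take p w" "filter (\<lambda>x. x \<noteq> N) (drop p w) = drop p w"
    using assms by (auto simp: filter_id_conv dest: in_set_takeD in_set_dropD)
  then show ?thesis
    by (simp add: insert_block_def)
qed

text \<open>With \<open>filter_insert_block\<close> this inverts insertion: deleting
  \<open>N\<close> recovers the word, the prefix before the first \<open>N\<close> recovers the
  gap.\<close>

lemma length_takeWhile_insert_block: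
  assumes "N \<notin> set w" "0 < a" "p \<le> length w"
  shows "length (takeWhile (\<lambda>x. x \<noteq> N) (insert_block N a w p)) = p"
proof -
  have "takeWhile (\<lambda>x. x \<noteq> N) (insert_block N a w p) = take p w"
    using assms by (cases a) (auto simp: insert_block_def takeWhile_append dest: in_set_takeD)
  then show ?thesis
    using assms by simp
qed

lemma nth_block:
  assumes "(u @ replicate a x @ v) ! l = x" "l < length (u @ replicate a x @ v)"
    "x \<notin> set u" "x \<notin> set v"
  shows "length u \<le> l \<and> l < length u + a"
proof -
  have "l < length u \<Longrightarrow> u ! l \<in> set u"
    "length u + a \<le> l \<Longrightarrow> v ! (l - length u - a) \<in> set v"
    using assms(2) by auto
  then show ?thesis using assms by (auto simp: nth_append not_less split: if_splits)
qed

text \<open>A valley \<open>x y x\<close> with \<open>x\<close> different from \<open>N\<close>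
  survives deletion of the block and so already lies in \<open>w\<close>. If \<open>x = N\<close>,
  both outer positions lie in the block; since it is contiguous, the middle letter is
  \<open>N\<close> as well.\<close>

lemma avoids_valleys_insert_block:
  assumes "\<forall>x\<in>set w. x < N" "avoids_valleys w"
  shows "avoids_valleys (insert_block N a w p)"
  unfolding avoids_valleys_def
proof (intro allI impI notI)
  fix x y assume xy: "y < x" "subseq [x, y, x] (insert_block N a w p)"
  have N: "N \<notin> set w" using assms by auto
  have sub: "{x, y} \<subseteq> set (insert_block N a w p)"
    using list_emb_set[OF xy(2)] by auto
  show False
  proof (cases "x = N")
    case False
    then have "y \<noteq> N"
      using xy sub assms by (auto simp: insert_block_def dest!: in_set_takeD in_set_dropD)
    then have "subseq [x, y, x] w"
      using subseq_filter[OF xy(2), of "\<lambda>x. x \<noteq> N"] False by (simp add: filter_insert_block[OF N])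
    then show False using assms xy by (auto simp: avoids_valleys_def)
  next
    case True
    obtain i s j where *: "i < s" "s < j" "j < length (insert_block N a w p)"
      "insert_block N a w p ! i = N" "insert_block N a w p ! s = y" "insert_block N a w p ! j = N"
      using xy(2) True by (auto simp: subseq_triple_iff)
    let ?q = "length (take p w)"
    have block: "?q \<le> l \<and> l < ?q + a"
      if "insert_block N a w p ! l = N" "l < length (insert_block N a w p)" for l
      using nth_block[of "take p w" a N "drop p w" l] that N in_set_takeD[of N p w]
        in_set_dropD[of N p w] unfolding insert_block_def by blast
    have "?q \<le> s \<and> s < ?q + a"
      using block[of i] block[of j] * by auto
    then have "insert_block N a w p ! s = N"
      by (auto simp: insert_block_def nth_append simp del: length_take)
    then show False using * xy True by simp
  qed
qed

text \<open>Copies of the maximum \<open>N\<close> are adjacent: a second run of \<open>N\<close>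
  would be separated from the first by a smaller letter, which is a valley.\<close>

lemma avoids_valleys_conv_insert_block:
  assumes "\<forall>x\<in>set w. x \<le> N" "avoids_valleys w" "N \<in> set w"
  obtains u p where "w = insert_block N (count_list w N) u p" "p \<le> length u"
    "u = filter (\<lambda>x. x \<noteq> N) w"
proof -
  obtain a b where w: "w = a @ N # b" "N \<notin> set a"
    using assms(3) by (auto dest: split_list_first)
  \<comment> \<open>The run starting at the first \<open>N\<close> has \<open>c + 1\<close> letters,
    and \<open>v\<close> is what follows it.\<close>
  define v where "v = dropWhile (\<lambda>x. x = N) b"
  define c where "c = length (takeWhile (\<lambda>x. x = N) b)"
  have "takeWhile (\<lambda>x. x = N) b = replicate c N"
    unfolding c_def by (rule replicate_length_same[symmetric]) (auto dest: set_takeWhileD)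
  then have b: "b = replicate c N @ v"
    using takeWhile_dropWhile_id[of "\<lambda>x. x = N" b] by (simp add: v_def)
  have v: "N \<notin> set v"
  proof
    assume Nv: "N \<in> set v"
    then obtain y v' where v: "v = y # v'" by (cases v) auto
    then have "y \<noteq> N"
      using hd_dropWhile[of "\<lambda>x. x = N" b] by (simp add: v_def)
    moreover have "y \<le> N"
      using assms(1) by (simp add: w(1) b v)
    moreover have "subseq [N, y, N] w"
    proof -
      have "subseq [y, N] v"
        using Nv \<open>y \<noteq> N\<close> by (simp add: v subseq_singleton_left)
      then show ?thesis
        unfolding w(1) b by (intro subseq_drop_many subseq_Cons2)
    qed
    ultimately show False
      using assms(2) by (auto simp: avoids_valleys_def)
  qed
  have count: "count_list w N = Suc c"
    using w(2) v by (auto simp: w(1) b count_list_eq_length_filter filter_empty_conv)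
  have f: "filter (\<lambda>x. x \<noteq> N) w = a @ v"
  proof -
    have "filter (\<lambda>x. x \<noteq> N) a = a" "filter (\<lambda>x. x \<noteq> N) v = v"
      using w(2) v by (auto simp: filter_id_conv)
    then show ?thesis by (simp add: w(1) b)
  qed
  show ?thesis
    by (rule that[of "a @ v" "length a"])
       (simp_all add: insert_block_def count f, simp add: w(1) b)
qed

lemma stirling_perms_snoc:
  assumes "0 < a"
  shows "bij_betw (\<lambda>(w, p). insert_block (Suc (length k)) a w p)
           (stirling_perms k \<times> {..sum_list k}) (stirling_perms (k @ [a]))"
proof -
  let ?N = "Suc (length k)"
  \<comment> \<open>Left inverse of the insertion map.\<close>
  let ?g = "\<lambda>w. (filter (\<lambda>x. x \<noteq> ?N) w, length (takeWhile (\<lambda>x. x \<noteq> ?N) w))"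
  have notin: "?N \<notin> set w" if "w \<in> stirling_perms k" for w
    using stirling_perm_letter_le[OF that, of ?N] by auto
  have inj: "inj_on (\<lambda>(w, p). insert_block ?N a w p) (stirling_perms k \<times> {..sum_list k})"
    by (rule inj_on_inverseI[of _ ?g])
       (auto simp: filter_insert_block length_takeWhile_insert_block notin assms length_stirling_perm)
  have into: "insert_block ?N a w p \<in> stirling_perms (k @ [a])"
    if "w \<in> stirling_perms k" for w p
  proof -
    have "mset (take p w) + mset (drop p w) = mset w"
      by (metis append_take_drop_id mset_append)
    then have "mset (insert_block ?N a w p) = tuple_mset (k @ [a])"
      using that by (simp add: stirling_perms_def insert_block_def)
    moreover have "avoids_valleys (insert_block ?N a w p)"
      using that stirling_perm_letter_le[OF that]
      by (intro avoids_valleys_insert_block) (auto simp: stirling_perms_altdef less_Suc_eq_le)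
    ultimately show ?thesis by (simp add: stirling_perms_altdef)
  qed
  have onto: "\<exists>u p. w = insert_block ?N a u p \<and> u \<in> stirling_perms k \<and> p \<le> sum_list k"
    if w: "w \<in> stirling_perms (k @ [a])" for w
  proof -
    have m: "mset w = tuple_mset k + replicate_mset a ?N" and av: "avoids_valleys w"
      using w by (auto simp: stirling_perms_altdef)
    have k: "?N \<notin># tuple_mset k" using set_tuple_mset_le[of ?N k] by auto
    have "\<forall>x\<in>set w. x \<le> ?N"
      using stirling_perm_letter_le[OF w] by auto
    moreover have "?N \<in># mset w" using assms by (simp add: m)
    ultimately obtain u p where u: "w = insert_block ?N (count_list w ?N) u p" "p \<le> length u"
      "u = filter (\<lambda>x. x \<noteq> ?N) w"
      using av by (auto elim: avoids_valleys_conv_insert_block)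
    have "count_list w ?N = count (mset w) ?N" by (simp add: count_mset count_list_eq_length_filter)
    also have "\<dots> = a" using k by (simp add: m not_in_iff)
    finally have c: "count_list w ?N = a" .
    have "mset u = filter_mset (\<lambda>x. x \<noteq> ?N) (tuple_mset k)"
      by (simp add: u(3) m)
    also have "\<dots> = tuple_mset k"
      using k by (auto simp: filter_mset_eq_conv)
    finally have "mset u = tuple_mset k" .
    moreover have "avoids_valleys u"
      using av unfolding u(3) avoids_valleys_def
      by (meson subseq_filter_left subseq_order.order_trans)
    ultimately have "u \<in> stirling_perms k" by (simp add: stirling_perms_altdef)
    then show ?thesis using u c length_stirling_perm by metis
  qed
  show ?thesis
    unfolding bij_betw_def using inj into onto by fast
qed

section \<open>Descents\<close>

definition des :: "nat list \<Rightarrow> nat" where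
  "des w = card (descents w)"

lemma finite_descents [simp]: "finite (descents w)"
  by (rule finite_subset[of _ "{..<length w}"]) (auto simp: descents_def)

lemma des_Nil [simp]: "des [] = 0"
  by (simp add: des_def descents_def)

lemma des_pos: "w \<noteq> [] \<Longrightarrow> 0 < des w"
  unfolding des_def by (auto simp: card_gt_0_iff descents_def intro!: exI[of _ "length w - 1"])

lemma des_Cons:
  "des (x # w) = des w + (if w = [] \<or> x > hd w then 1 else 0)"
proof -
  have "descents (x # w) = Suc ` descents w \<union> (if w = [] \<or> x > hd w then {0} else {})" (is "?L = ?R")
  proof (intro set_eqI)
    fix i show "i \<in> ?L \<longleftrightarrow> i \<in> ?R"
      by (cases i; cases w) (auto simp: descents_def)
  qed
  then show ?thesis by (auto simp: des_def card_image)
qed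

text \<open>The end of \<open>u\<close> is a descent of \<open>u\<close> alone, but in
  \<open>u @ v\<close> only if \<open>last u > hd v\<close>. The correction stands on the left to
  avoid truncated subtraction.\<close>

lemma des_append:
  "des (u @ v) + (if u \<noteq> [] \<and> v \<noteq> [] \<and> last u \<le> hd v then 1 else 0) = des u + des v"
proof (induction u)
  case (Cons x u)
  then show ?case by (cases u; cases v) (auto simp: des_Cons split: if_splits)
qed simp

lemma des_replicate: "0 < a \<Longrightarrow> des (replicate a N) = 1"
proof (induction a)
  case (Suc a)
  then show ?case by (cases a) (auto simp: des_Cons)
qed simp

text \<open>Entering the block is never a descent and leaving it always is, also at the end of the
  word. So the block contributes exactly one descent and absorbs the one at its gap, if there was
  one. Gap \<open>p\<close> follows position \<open>p - 1\<close>, hence \<open>Suc\<close>.\<close>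

lemma des_insert_block:
  assumes "\<forall>x\<in>set w. x < N" "0 < a" "p \<le> length w"
  shows "des (insert_block N a w p) = des w + (if p \<in> Suc ` descents w then 0 else 1)"
proof -
  let ?u = "take p w" and ?v = "drop p w"
  have ne: "replicate a N \<noteq> []" using assms by simp
  have u: "last ?u < N" if "?u \<noteq> []"
    using assms(1) last_in_set[OF that] by (auto dest: in_set_takeD)
  have v: "hd ?v < N" if "?v \<noteq> []"
    using assms(1) hd_in_set[OF that] by (auto dest: in_set_dropD)
  have 1: "des (replicate a N @ ?v) = 1 + des ?v"
    using des_append[of "replicate a N" ?v] v assms(2) by (auto simp: des_replicate split: if_splits)
  have "hd (replicate a N @ ?v) = N" using assms(2) by (cases a) auto
  moreover have "des (?u @ replicate a N @ ?v) = des (insert_block N a w p)"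
    by (simp add: insert_block_def)
  ultimately have 2: "des (insert_block N a w p) + (if ?u \<noteq> [] then 1 else 0) = des ?u + (1 + des ?v)"
    using des_append[of ?u "replicate a N @ ?v"] u 1 ne
    by (cases "?u = []") (simp_all del: take_eq_Nil)
  have 3: "des w + (if ?u \<noteq> [] \<and> \<not> (?v = [] \<or> last ?u > hd ?v) then 1 else 0) = des ?u + des ?v"
    using des_append[of ?u ?v] by (simp only: append_take_drop_id de_Morgan_disj not_less)
  \<comment> \<open>The case \<open>?v = []\<close> is the final position, a descent by
    convention.\<close>
  have 4: "p \<in> Suc ` descents w \<longleftrightarrow> ?u \<noteq> [] \<and> (?v = [] \<or> last ?u > hd ?v)"
  proof (cases p)
    case (Suc q)
    then have "last ?u = w ! q" using assms(3) by (simp add: take_Suc_conv_app_nth)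
    moreover have "hd ?v = w ! p" if "?v \<noteq> []" using that by (simp add: hd_drop_conv_nth)
    ultimately show ?thesis
      using Suc assms(3) by (auto simp: descents_def image_iff)
  qed auto
  show ?thesis
  proof (cases "?u = []")
    case True
    then show ?thesis using 2 3 unfolding 4 by simp
  next
    case False
    then show ?thesis
      using 2 3 unfolding 4 by (cases "?v = [] \<or> last ?u > hd ?v") (simp_all del: take_eq_Nil drop_eq_Nil)
  qed
qed

text \<open>The right-hand side does not depend on \<open>a\<close>: only the exponent \<open>K + 1\<close> of the denominator of the
  series sees the multiplicity of the largest letter.\<close>

lemma sum_stirling_perms_snoc:
  fixes f :: "nat \<Rightarrow> rat"
  assumes "0 < a"
  shows "(\<Sum>w\<in>stirling_perms (k @ [a]). f (des w)) =
    (\<Sum>w\<in>stirling_perms k. of_nat (des w) * f (des w)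
       + (of_nat (sum_list k) + 1 - of_nat (des w)) * f (Suc (des w)))"
proof -
  let ?N = "Suc (length k)"
  have "(\<Sum>w\<in>stirling_perms (k @ [a]). f (des w)) =
    (\<Sum>(w, p)\<in>stirling_perms k \<times> {..sum_list k}. f (des (insert_block ?N a w p)))"
    using sum.reindex_bij_betw[OF stirling_perms_snoc[OF assms, of k], of "\<lambda>w. f (des w)"]
    by (simp add: case_prod_unfold)
  also have "\<dots> = (\<Sum>w\<in>stirling_perms k. \<Sum>p\<le>sum_list k. f (des (insert_block ?N a w p)))"
    by (rule sum.cartesian_product[symmetric])
  also have "\<dots> = (\<Sum>w\<in>stirling_perms k. of_nat (des w) * f (des w)
       + (of_nat (sum_list k) + 1 - of_nat (des w)) * f (Suc (des w)))"
  proof (rule sum.cong[OF refl])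
    fix w assume w: "w \<in> stirling_perms k"
    let ?D = "Suc ` descents w"
    have D: "?D \<subseteq> {..sum_list k}"
      using length_stirling_perm[OF w] by (auto simp: descents_def)
    have card: "card ?D = des w" by (simp add: card_image des_def)
    have card': "of_nat (card ({..sum_list k} - ?D)) = (of_nat (sum_list k) + 1 - of_nat (des w) :: rat)"
      using card_mono[OF _ D] card by (simp add: card_Diff_subset[OF _ D] of_nat_diff)
    \<comment> \<open>Of the \<open>sum_list k + 1\<close> gaps, \<open>des w\<close> follow a
      descent and keep the count; all others raise it by one.\<close>
    have "(\<Sum>p\<le>sum_list k. f (des (insert_block ?N a w p))) =
        (\<Sum>p\<le>sum_list k. if p \<in> ?D then f (des w) else f (Suc (des w)))"
      using stirling_perm_letter_le[OF w] length_stirling_perm[OF w] assms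
      by (intro sum.cong) (auto simp: des_insert_block less_Suc_eq_le)
    also have "\<dots> = (\<Sum>p\<in>?D. f (des w)) + (\<Sum>p\<in>{..sum_list k} - ?D. f (Suc (des w)))"
      using D by (subst sum.If_cases) (auto simp: Int_absorb1 Diff_eq)
    finally show "(\<Sum>p\<le>sum_list k. f (des (insert_block ?N a w p))) =
      of_nat (des w) * f (des w) + (of_nat (sum_list k) + 1 - of_nat (des w)) * f (Suc (des w))"
      by (simp only: sum_constant card card')
  qed
  finally show ?thesis .
qed

text \<open>Each new largest letter adds at most one descent.\<close>

lemma des_stirling_perm_le:
  "\<forall>x\<in>set k. 0 < x \<Longrightarrow> w \<in> stirling_perms k \<Longrightarrow> des w \<le> length k"
proof (induction k arbitrary: w rule: rev_induct)
  case Nil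
  then show ?case by (simp add: stirling_perms_Nil)
next
  case (snoc a k)
  then have "0 < a" by simp
  from bij_betw_imp_surj_on[OF stirling_perms_snoc[OF this, of k]] snoc.prems(2)
  obtain u p where u: "u \<in> stirling_perms k" "p \<le> sum_list k" "w = insert_block (Suc (length k)) a u p"
    by force
  then have "des w \<le> Suc (des u)"
    using des_insert_block[of u "Suc (length k)" a p] \<open>0 < a\<close> stirling_perm_letter_le[OF u(1)]
      length_stirling_perm[OF u(1)] by (auto simp: less_Suc_eq_le)
  also have "\<dots> \<le> Suc (length k)" using snoc u by simp
  finally show ?case by simp
qed

lemma des_stirling_perm_pos:
  assumes "\<forall>x\<in>set k. 0 < x" "k \<noteq> []" "w \<in> stirling_perms k"
  shows "0 < des w"
proof -
  have "0 < sum_list k" using assms(1,2) by (cases k) auto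
  then have "0 < length w" by (simp only: length_stirling_perm[OF assms(3)])
  then show ?thesis by (intro des_pos) simp
qed

lemma stirling_perms_nonempty: "\<forall>x\<in>set k. 0 < x \<Longrightarrow> stirling_perms k \<noteq> {}"
proof (induction k rule: rev_induct)
  case (snoc a k)
  then show ?case
    using bij_betw_imp_surj_on[OF stirling_perms_snoc[of a k]] by fastforce
qed (simp add: stirling_perms_Nil)

section \<open>The common polynomial function\<close>

text \<open>Each word with \<open>d\<close> descents contributes \<open>x\<^sup>d / (1 - x)\<^sup>K\<^sup>+\<^sup>1\<close> to the series \<open>G\<close>, whose \<open>m\<close>-th
  coefficient is \<open>binomial (m - d + K) K\<close>; the generalised binomial coefficient makes this a
  polynomial in \<open>m\<close> and covers the vanishing coefficients \<open>m < d\<close> because \<open>d \<le> K\<close>.\<close>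

definition stirling_fn :: "nat list \<Rightarrow> rat \<Rightarrow> rat" where
  "stirling_fn k x =
     (\<Sum>w\<in>stirling_perms k. (x - of_nat (des w) + of_nat (sum_list k)) gchoose sum_list k)"

lemma stirling_fn_Nil [simp]: "stirling_fn [] x = 1"
  by (simp add: stirling_fn_def stirling_perms_Nil)

text \<open>The identity holds word by word: Pascal's rule and absorption turn the two kinds of gaps
  into the factor \<open>d + (y - K) = x\<close>, where \<open>y = x - d + K\<close>.\<close>

lemma stirling_fn_snoc_1: "stirling_fn (k @ [1]) x = x * stirling_fn k x"
proof -
  let ?K = "sum_list k"
  let ?f = "\<lambda>d. (x - of_nat d + of_nat (Suc ?K)) gchoose Suc ?K"
  have key: "of_nat d * ?f d + (of_nat ?K + 1 - of_nat d) * ?f (Suc d) =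
      x * ((x - of_nat d + of_nat ?K) gchoose ?K)" for d
  proof -
    define y where "y = x - of_nat d + of_nat ?K"
    have 1: "?f d = (y gchoose ?K) + (y gchoose Suc ?K)"
      using gbinomial_Suc_Suc[of y ?K] by (simp add: y_def algebra_simps)
    have 2: "?f (Suc d) = y gchoose Suc ?K"
      by (simp add: y_def algebra_simps)
    have 3: "(of_nat ?K + 1) * (y gchoose Suc ?K) = (y - of_nat ?K) * (y gchoose ?K)"
      using gbinomial_mult_1[of y ?K] by (simp add: algebra_simps)
    have "of_nat d * ?f d + (of_nat ?K + 1 - of_nat d) * ?f (Suc d) =
        of_nat d * (y gchoose ?K) + (of_nat ?K + 1) * (y gchoose Suc ?K)"
      unfolding 1 2 by (simp add: algebra_simps)
    also have "\<dots> = x * (y gchoose ?K)"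
      unfolding 3 by (simp add: y_def algebra_simps)
    finally show ?thesis by (simp add: y_def)
  qed
  have "stirling_fn (k @ [1]) x = (\<Sum>w\<in>stirling_perms (k @ [1]). ?f (des w))"
    by (simp add: stirling_fn_def)
  also have "\<dots> = (\<Sum>w\<in>stirling_perms k. x * ((x - of_nat (des w) + of_nat ?K) gchoose ?K))"
    by (subst sum_stirling_perms_snoc) (simp_all only: key zero_less_one)
  finally show ?thesis by (simp add: stirling_fn_def sum_distrib_left)
qed

text \<open>Pascal's rule splits each summand into its value at \<open>x - 1\<close> and a binomial
  with lower index reduced by one, the one belonging to \<open>k @ [a]\<close>.\<close>

lemma stirling_fn_snoc_Suc:
  assumes "0 < a"
  shows "stirling_fn (k @ [Suc a]) x = stirling_fn (k @ [Suc a]) (x - 1) + stirling_fn (k @ [a]) x"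
proof -
  let ?K = "sum_list k + a"
  let ?f = "\<lambda>x d. (x - of_nat d + of_nat (Suc ?K)) gchoose Suc ?K"
  let ?g = "\<lambda>d. (x - of_nat d + of_nat ?K) gchoose ?K"
  have "?f x d = ?f (x - 1) d + ?g d" for d
    using gbinomial_Suc_Suc[of "x - of_nat d + of_nat ?K" ?K] by (simp add: algebra_simps)
  note pascal = this
  have "stirling_fn (k @ [Suc a]) x = (\<Sum>w\<in>stirling_perms (k @ [Suc a]). ?f x (des w))"
    by (simp add: stirling_fn_def)
  also have "\<dots> = (\<Sum>w\<in>stirling_perms (k @ [Suc a]). ?f (x - 1) (des w)) +
      (\<Sum>w\<in>stirling_perms (k @ [Suc a]). ?g (des w))"
    by (subst pascal) (simp add: sum.distrib)
  \<comment> \<open>The distribution of descents is the same for every positive multiplicity of the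
    largest letter.\<close>
  also have "(\<Sum>w\<in>stirling_perms (k @ [Suc a]). ?g (des w)) = (\<Sum>w\<in>stirling_perms (k @ [a]). ?g (des w))"
    using sum_stirling_perms_snoc[of a ?g k] sum_stirling_perms_snoc[of "Suc a" ?g k] assms
    by (simp only: zero_less_Suc)
  finally show ?thesis by (simp add: stirling_fn_def)
qed

section \<open>Coefficients of the generating series\<close>

text \<open>Multiplication by \<open>1 - fps_X\<close> takes backward differences, which lower the
  binomial by Pascal's rule.\<close>

lemma fps_nth_inverse_one_minus_X_power:
  "fps_nth (inverse ((1 - fps_X) ^ Suc K :: 'a :: field_char_0 fps)) m = of_nat ((m + K) choose K)"
proof -
  have "(1 - fps_X) ^ Suc K * Abs_fps (\<lambda>m. of_nat ((m + K) choose K)) = (1 :: 'a fps)"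
  proof (induction K)
    case 0
    show ?case
      by (rule fps_ext) (simp add: left_diff_distrib)
  next
    case (Suc K)
    have "(1 - fps_X) * Abs_fps (\<lambda>m. of_nat ((m + Suc K) choose Suc K)) =
        (Abs_fps (\<lambda>m. of_nat ((m + K) choose K)) :: 'a fps)"
    proof (rule fps_ext)
      fix m
      show "fps_nth ((1 - fps_X) * Abs_fps (\<lambda>m. of_nat ((m + Suc K) choose Suc K))) m =
        fps_nth (Abs_fps (\<lambda>m. of_nat ((m + K) choose K)) :: 'a fps) m"
        by (cases m) (simp_all add: left_diff_distrib)
    qed
    then show ?case using Suc by (simp only: power_Suc2[of _ "Suc K"] mult.assoc)
  qed
  then have "inverse ((1 - fps_X) ^ Suc K :: 'a fps) = Abs_fps (\<lambda>m. of_nat ((m + K) choose K))"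
    by (metis fps_inverse_unique)
  then show ?thesis by simp
qed

text \<open>Stated for arbitrary coefficients and index sets to serve both series; the guard
  \<open>m < e i\<close> keeps the natural subtraction from truncating.\<close>

lemma fps_nth_numerator_divide:
  fixes c e :: "nat \<Rightarrow> nat"
  shows "fps_nth ((\<Sum>i\<in>I. of_nat (c i) * fps_X ^ e i) / (1 - fps_X :: rat fps) ^ (K + 1)) m =
    (\<Sum>i\<in>I. of_nat (c i) * (if m < e i then 0 else of_nat ((m - e i + K) choose K)))"
proof -
  have "(\<Sum>i\<in>I. of_nat (c i) * fps_X ^ e i) / (1 - fps_X :: rat fps) ^ (K + 1) =
      (\<Sum>i\<in>I. of_nat (c i) * (fps_X ^ e i * inverse ((1 - fps_X) ^ Suc K)))"
    by (subst fps_divide_unit) (simp_all add: sum_distrib_right mult.assoc)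
  then show ?thesis
    by (simp add: fps_sum_nth fps_mult_of_nat_nth fps_X_power_mult_nth fps_nth_inverse_one_minus_X_power
        del: power_Suc cong: if_cong)
qed

text \<open>Groups the words by descent number, which lies between 1 and \<open>length k\<close> for
  a nonempty tuple.\<close>

lemma sum_stirling_A:
  fixes f :: "nat \<Rightarrow> rat"
  assumes "\<forall>x\<in>set k. 0 < x" "k \<noteq> []"
  shows "(\<Sum>i = 1..length k. of_nat (stirling_A k i) * f i) = (\<Sum>w\<in>stirling_perms k. f (des w))"
proof -
  have "des ` stirling_perms k \<subseteq> {1..length k}"
    using des_stirling_perm_le[OF assms(1)] des_stirling_perm_pos[OF assms] by (force simp: Suc_le_eq)
  then have "(\<Sum>w\<in>stirling_perms k. f (des w)) =
      (\<Sum>i = 1..length k. \<Sum>w\<in>{w \<in> stirling_perms k. des w = i}. f (des w))"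
    by (intro sum.group[symmetric] finite_stirling_perms) auto
  also have "\<dots> = (\<Sum>i = 1..length k. of_nat (stirling_A k i) * f i)"
    by (intro sum.cong) (auto simp: stirling_A_def des_def)
  finally show ?thesis by simp
qed

lemma length_le_sum_list: "\<forall>x\<in>set k. 0 < x \<Longrightarrow> length k \<le> sum_list (k :: nat list)"
  by (induction k) (auto simp: Suc_le_eq)

lemma stirling_B_eq_stirling_fn:
  assumes "\<forall>x\<in>set k. 0 < x"
  shows "stirling_B k m = stirling_fn k (of_nat m)"
proof (cases "k = []")
  case False
  let ?K = "sum_list k"
  let ?f = "\<lambda>i. if m < i then 0 else of_nat ((m - i + ?K) choose ?K) :: rat"
  have "stirling_B k m = (\<Sum>i = 1..length k. of_nat (stirling_A k i) * ?f i)"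
    using False by (simp only: stirling_B_def G_series_def fps_nth_numerator_divide if_False)
  also have "\<dots> = (\<Sum>w\<in>stirling_perms k. ?f (des w))"
    by (rule sum_stirling_A[OF assms False])
  also have "\<dots> = stirling_fn k (of_nat m)"
    unfolding stirling_fn_def
  proof (intro sum.cong refl)
    fix w assume "w \<in> stirling_perms k"
    then have d: "des w \<le> ?K"
      using des_stirling_perm_le[OF assms] length_le_sum_list[OF assms] by force
    then have "of_nat m - of_nat (des w) + of_nat ?K = (of_nat (m + ?K - des w) :: rat)"
      by (simp add: of_nat_diff)
    \<comment> \<open>For \<open>m < des w\<close> the upper index is below \<open>?K\<close>, so
      the binomial vanishes as the guard demands.\<close>
    moreover have "?f (des w) = of_nat ((m + ?K - des w) choose ?K)"
      using d by (cases "m < des w") (auto simp: binomial_eq_0 not_less)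
    ultimately show "?f (des w) = (of_nat m - of_nat (des w) + of_nat ?K) gchoose ?K"
      by (simp add: binomial_gbinomial)
  qed
  finally show ?thesis .
qed (simp add: stirling_B_def)

lemma stirling_b_eq_stirling_fn:
  assumes "\<forall>x\<in>set k. 0 < x"
  shows "stirling_b k m = (-1) ^ sum_list k * stirling_fn k (- of_nat m)"
proof (cases "k = []")
  case False
  let ?K = "sum_list k" and ?n = "length k"
  let ?f = "\<lambda>i. if m < ?K + 1 - i then 0 else of_nat ((m - (?K + 1 - i) + ?K) choose ?K) :: rat"
  have n: "?n \<le> ?K" by (rule length_le_sum_list[OF assms])
  have "stirling_b k m = (\<Sum>i = ?K - ?n + 1..?K. of_nat (stirling_A k (?K + 1 - i)) *
      (if m < i then 0 else of_nat ((m - i + ?K) choose ?K)))"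
    using False by (simp only: stirling_b_def g_series_def fps_nth_numerator_divide if_False)
  also have "\<dots> = (\<Sum>i = 1..?n. of_nat (stirling_A k i) * ?f i)"
    \<comment> \<open>The reflection reversing the numerator of \<open>g_series\<close> is its own
      inverse.\<close>
    using n by (intro sum.reindex_bij_witness[of _ "\<lambda>i. ?K + 1 - i" "\<lambda>i. ?K + 1 - i"]) auto
  also have "\<dots> = (\<Sum>w\<in>stirling_perms k. ?f (des w))"
    by (rule sum_stirling_A[OF assms False])
  also have "\<dots> = (\<Sum>w\<in>stirling_perms k.
      (-1) ^ ?K * ((- of_nat m - of_nat (des w) + of_nat ?K) gchoose ?K))"
  proof (intro sum.cong refl)
    fix w assume w: "w \<in> stirling_perms k"
    then have d: "des w \<le> ?K"
      using des_stirling_perm_le[OF assms] n by force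
    have "0 < des w" by (rule des_stirling_perm_pos[OF assms False w])
    then have cast: "of_nat (m + des w - 1) = (of_nat m + of_nat (des w) - 1 :: rat)"
      by (simp add: of_nat_diff)
    have arg: "of_nat ?K - (of_nat m + of_nat (des w) - 1) - 1 =
        (- of_nat m - of_nat (des w) + of_nat ?K :: rat)"
      by simp
    have "?f (des w) = of_nat ((m + des w - 1) choose ?K)"
    proof (cases "m < ?K + 1 - des w")
      case True
      then have "m + des w - 1 < ?K" using d \<open>0 < des w\<close> by linarith
      with True show ?thesis by (simp add: binomial_eq_0)
    next
      case False
      then have "m - (?K + 1 - des w) + ?K = m + des w - 1" using d \<open>0 < des w\<close> by linarith
      with False show ?thesis by simp
    qed
    also have "\<dots> = (of_nat m + of_nat (des w) - 1) gchoose ?K"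
      by (simp only: binomial_gbinomial cast)
    \<comment> \<open>Reciprocity: negating the upper index \<open>m + d - 1\<close> gives the
      summand of \<open>stirling_fn\<close> at \<open>-m\<close>.\<close>
    also have "\<dots> = (-1) ^ ?K * ((- of_nat m - of_nat (des w) + of_nat ?K) gchoose ?K)"
      using gbinomial_negated_upper[of "of_nat m + of_nat (des w) - 1 :: rat" ?K]
      unfolding arg .
    finally show "?f (des w) =
        (-1) ^ ?K * ((- of_nat m - of_nat (des w) + of_nat ?K) gchoose ?K)" .
  qed
  finally show ?thesis by (simp add: stirling_fn_def sum_distrib_left)
qed (simp add: stirling_b_def)

text \<open>Every summand vanishes: since \<open>1 \<le> des w \<le> length k\<close>, its upper
  index is a natural number below \<open>sum_list k\<close>.\<close>

lemma stirling_fn_eq_0: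
  assumes "\<forall>x\<in>set k. 0 < x" "k \<noteq> []" "j \<le> sum_list k - length k"
  shows "stirling_fn k (- of_nat j) = 0"
  unfolding stirling_fn_def
proof (intro sum.neutral ballI)
  fix w assume w: "w \<in> stirling_perms k"
  let ?K = "sum_list k"
  have n: "length k \<le> ?K" by (rule length_le_sum_list[OF assms(1)])
  have "0 < des w" by (rule des_stirling_perm_pos[OF assms(1,2) w])
  moreover have "des w \<le> length k" by (rule des_stirling_perm_le[OF assms(1) w])
  ultimately have "j + des w \<le> ?K" and lt: "?K - (j + des w) < ?K"
    using n assms(3) by linarith+
  then have "- of_nat j - of_nat (des w) + of_nat ?K = (of_nat (?K - (j + des w)) :: rat)"
    by (simp add: of_nat_diff)
  then have "(- of_nat j - of_nat (des w) + of_nat ?K :: rat) gchoose ?K =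
      of_nat ((?K - (j + des w)) choose ?K)"
    by (simp only: binomial_gbinomial)
  also have "\<dots> = 0"
    using lt by (simp only: binomial_eq_0 of_nat_0)
  finally show "(- of_nat j - of_nat (des w) + of_nat ?K :: rat) gchoose ?K = 0" .
qed

section \<open>Degree and leading coefficient\<close>

text \<open>The binomial coefficient of \<open>x + c\<close> over \<open>K\<close> as a polynomial
  in \<open>x\<close>, factored so that degree and leading coefficient can be read off.\<close>

definition gbinomial_poly :: "'a :: field_char_0 \<Rightarrow> nat \<Rightarrow> 'a poly" where
  "gbinomial_poly c K = smult (1 / fact K) (\<Prod>i<K. [:c - of_nat i, 1:])"

lemma poly_gbinomial_poly: "poly (gbinomial_poly c K) x = (x + c) gchoose K"
  by (simp add: gbinomial_poly_def gbinomial_prod_rev poly_prod atLeast0LessThan algebra_simps)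

lemma degree_gbinomial_poly: "degree (gbinomial_poly c K) = K"
  by (simp add: gbinomial_poly_def degree_prod_sum_eq)

lemma coeff_gbinomial_poly: "coeff (gbinomial_poly c K) K = 1 / fact K"
  using lead_coeff_prod[of "\<lambda>i. [:c - of_nat i, 1:]" "{..<K}"]
  by (simp add: gbinomial_poly_def degree_prod_sum_eq)

definition stirling_poly :: "nat list \<Rightarrow> rat poly" where
  "stirling_poly k =
     (\<Sum>w\<in>stirling_perms k. gbinomial_poly (of_nat (sum_list k) - of_nat (des w)) (sum_list k))"

lemma poly_stirling_poly: "poly (stirling_poly k) x = stirling_fn k x"
  by (simp add: stirling_poly_def stirling_fn_def poly_sum poly_gbinomial_poly algebra_simps)

lemma coeff_stirling_poly:
  "coeff (stirling_poly k) (sum_list k) = of_nat (card (stirling_perms k)) / fact (sum_list k)"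
  by (simp add: stirling_poly_def coeff_sum coeff_gbinomial_poly)

text \<open>No cancellation at the top: all summands have leading coefficient
  \<open>1 / fact K\<close> with \<open>K = sum_list k\<close>, and there is at least one
  summand.\<close>

lemma degree_stirling_poly:
  assumes "\<forall>x\<in>set k. 0 < x"
  shows "degree (stirling_poly k) = sum_list k"
proof (rule antisym)
  show "degree (stirling_poly k) \<le> sum_list k"
    unfolding stirling_poly_def
    by (intro degree_sum_le finite_stirling_perms) (simp add: degree_gbinomial_poly)
  show "sum_list k \<le> degree (stirling_poly k)"
    using stirling_perms_nonempty[OF assms] finite_stirling_perms[of k]
    by (intro le_degree) (simp add: coeff_stirling_poly)
qed

section \<open>Recurrences\<close>

text \<open>\<open>B j\<close> is the \<open>(j + 1)\<close>-fold iterated partial sum of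
  \<open>f\<close>, that is, its series is that of \<open>f\<close> divided by
  \<open>(1 - X)^(j + 1)\<close>.\<close>

lemma binomial_convolution_recurrence:
  fixes B :: "nat \<Rightarrow> nat \<Rightarrow> 'a :: comm_semiring_1"
  assumes "\<And>j. B j 0 = f 0" and "\<And>m. B 0 (Suc m) = B 0 m + f (Suc m)"
    and "\<And>j m. B (Suc j) (Suc m) = B (Suc j) m + B j (Suc m)"
  shows "B j m = (\<Sum>i = 0..m. f i * of_nat ((j + m - i) choose j))"
proof (induction j arbitrary: m)
  case 0
  show ?case by (induction m) (simp_all add: assms)
next
  case (Suc j)
  note IH = this
  show ?case
  proof (induction m)
    case (Suc m)
    have "B (Suc j) (Suc m) = (\<Sum>i = 0..m. f i * of_nat ((Suc j + m - i) choose Suc j)) +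
        (\<Sum>i = 0..Suc m. f i * of_nat ((j + Suc m - i) choose j))"
      by (simp only: assms Suc.IH IH)
    \<comment> \<open>The term \<open>i = Suc m\<close> has binomial 1 and is split off; the others
      merge by Pascal's rule.\<close>
    also have "\<dots> = (\<Sum>i = 0..m. f i * of_nat ((Suc j + m - i) choose Suc j) +
        f i * of_nat ((j + Suc m - i) choose j)) + f (Suc m)"
      by (simp add: sum.distrib add.assoc)
    also have "\<dots> = (\<Sum>i = 0..m. f i * of_nat ((Suc j + Suc m - i) choose Suc j)) + f (Suc m)"
      by (intro arg_cong2[of _ _ _ _ "(+)"] sum.cong refl) (simp add: Suc_diff_le algebra_simps)
    finally show ?case by simp
  qed (simp add: assms)
qed

text \<open>The same iteration with sums over strictly smaller indices, which shifts the upper index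
  of the kernel.\<close>

lemma binomial_convolution_recurrence':
  fixes B :: "nat \<Rightarrow> nat \<Rightarrow> 'a :: comm_semiring_1"
  assumes "\<And>j. B j 0 = 0" and "\<And>m. B 0 (Suc m) = B 0 m + f m"
    and "\<And>j m. B (Suc j) (Suc m) = B (Suc j) m + B j m"
  shows "B j m = (\<Sum>i<m. f i * of_nat ((m - i - 1) choose j))"
proof (induction j arbitrary: m)
  case 0
  show ?case by (induction m) (simp_all add: assms)
next
  case (Suc j)
  note IH = this
  show ?case
  proof (induction m)
    case (Suc m)
    have "B (Suc j) (Suc m) = (\<Sum>i<m. f i * of_nat ((m - i - 1) choose Suc j) +
        f i * of_nat ((m - i - 1) choose j))"
      by (simp only: assms Suc.IH IH sum.distrib)
    also have "\<dots> = (\<Sum>i<m. f i * of_nat ((Suc m - i - 1) choose Suc j))"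
    proof (intro sum.cong refl)
      fix i assume "i \<in> {..<m}"
      \<comment> \<open>Removes the truncated subtraction: the upper indices become \<open>d\<close>
        and \<open>Suc d\<close>.\<close>
      then obtain d where "m = Suc (i + d)" by (auto dest: less_imp_Suc_add)
      then show "f i * of_nat ((m - i - 1) choose Suc j) + f i * of_nat ((m - i - 1) choose j) =
          f i * of_nat ((Suc m - i - 1) choose Suc j)"
        by (simp add: algebra_simps)
    qed
    \<comment> \<open>The extra term \<open>i = m\<close> vanishes, its binomial being
      \<open>0 choose Suc j\<close>.\<close>
    finally show ?case by simp
  qed (simp add: assms)
qed

section \<open>Transfer to the coefficients \<open>stirling_B\<close> and
  \<open>stirling_b\<close>\<close>

lemma stirling_B_0: "\<forall>x\<in>set k. 0 < x \<Longrightarrow> k \<noteq> [] \<Longrightarrow> stirling_B k 0 = 0"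
  using stirling_fn_eq_0[of k 0] by (simp add: stirling_B_eq_stirling_fn)

lemma stirling_b_0: "\<forall>x\<in>set k. 0 < x \<Longrightarrow> k \<noteq> [] \<Longrightarrow> stirling_b k 0 = 0"
  using stirling_fn_eq_0[of k 0] by (simp add: stirling_b_eq_stirling_fn)

lemma stirling_B_snoc_1:
  "\<forall>x\<in>set k. 0 < x \<Longrightarrow> stirling_B (k @ [1]) m = of_nat m * stirling_B k m"
  using stirling_fn_snoc_1[of k "of_nat m"] by (simp add: stirling_B_eq_stirling_fn)

lemma stirling_b_snoc_1:
  "\<forall>x\<in>set k. 0 < x \<Longrightarrow> stirling_b (k @ [1]) m = of_nat m * stirling_b k m"
  using stirling_fn_snoc_1[of k "- of_nat m"] by (simp add: stirling_b_eq_stirling_fn)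

lemma stirling_B_snoc_Suc:
  assumes "\<forall>x\<in>set k. 0 < x" "0 < a"
  shows "stirling_B (k @ [Suc a]) (Suc m) = stirling_B (k @ [Suc a]) m + stirling_B (k @ [a]) (Suc m)"
  using stirling_fn_snoc_Suc[of a k "of_nat (Suc m)"] assms by (simp add: stirling_B_eq_stirling_fn)

text \<open>At \<open>x = -m\<close> the shift to \<open>x - 1\<close> leads from \<open>m\<close>
  to \<open>m + 1\<close>. The signs for \<open>Suc a\<close> and \<open>a\<close> are opposite, so
  the second term changes sides and keeps the argument \<open>m\<close>.\<close>

lemma stirling_b_snoc_Suc:
  assumes "\<forall>x\<in>set k. 0 < x" "0 < a"
  shows "stirling_b (k @ [Suc a]) (Suc m) = stirling_b (k @ [Suc a]) m + stirling_b (k @ [a]) m"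
proof -
  have "- of_nat (Suc m) = (- of_nat m - 1 :: rat)" by simp
  note fn = stirling_fn_snoc_Suc[OF assms(2), of k "- of_nat m", folded this]
  show ?thesis
    using assms by (simp add: stirling_b_eq_stirling_fn fn distrib_left del: of_nat_Suc)
qed

text \<open>Last entry 1 gives the sequence \<open>i * stirling_B k i\<close>; each further unit of
  the last entry is one partial summation, so \<open>a - 1\<close> of them are needed and
  \<open>j = a - 2\<close>.\<close>

lemma stirling_B_snoc_convolution:
  assumes "\<forall>x\<in>set k. 0 < x" "1 < a"
  shows "stirling_B (k @ [a]) m =
    (\<Sum>i = 0..m. of_nat i * stirling_B k i * of_nat ((a + m - i - 2) choose (a - 2)))"
proof -
  define j where "j = a - 2"
  have a: "a = Suc (Suc j)" using assms(2) by (simp add: j_def)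
  have "stirling_B (k @ [Suc (Suc j)]) m =
      (\<Sum>i = 0..m. of_nat i * stirling_B k i * of_nat ((j + m - i) choose j))"
  proof (rule binomial_convolution_recurrence[where B = "\<lambda>j. stirling_B (k @ [Suc (Suc j)])"])
    show "stirling_B (k @ [Suc (Suc 0)]) (Suc m) =
        stirling_B (k @ [Suc (Suc 0)]) m + of_nat (Suc m) * stirling_B k (Suc m)" for m
      using stirling_B_snoc_Suc[OF assms(1), of 1 m] stirling_B_snoc_1[OF assms(1), of "Suc m"]
      by simp
  qed (use assms(1) in \<open>auto simp: stirling_B_0 stirling_B_snoc_Suc\<close>)
  also have "\<dots> = (\<Sum>i = 0..m. of_nat i * stirling_B k i * of_nat ((a + m - i - 2) choose (a - 2)))"
    by (intro sum.cong refl) (simp add: a Suc_diff_le)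
  finally show ?thesis by (simp add: a)
qed

lemma stirling_b_snoc_convolution:
  assumes "\<forall>x\<in>set k. 0 < x" "1 < a"
  shows "stirling_b (k @ [a]) m =
    (\<Sum>i<m. of_nat i * stirling_b k i * of_nat ((m - i - 1) choose (a - 2)))"
proof -
  define j where "j = a - 2"
  have a: "a = Suc (Suc j)" using assms(2) by (simp add: j_def)
  have "stirling_b (k @ [Suc (Suc j)]) m =
      (\<Sum>i<m. of_nat i * stirling_b k i * of_nat ((m - i - 1) choose j))"
  proof (rule binomial_convolution_recurrence'[where B = "\<lambda>j. stirling_b (k @ [Suc (Suc j)])"])
    show "stirling_b (k @ [Suc (Suc 0)]) (Suc m) =
        stirling_b (k @ [Suc (Suc 0)]) m + of_nat m * stirling_b k m" for m
      using stirling_b_snoc_Suc[OF assms(1), of 1 m] stirling_b_snoc_1[OF assms(1), of m]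
      by simp
  qed (use assms(1) in \<open>auto simp: stirling_b_0 stirling_b_snoc_Suc\<close>)
  then show ?thesis by (simp add: a)
qed

theorem theorem1:
  fixes k :: "nat list" and n K :: nat
  assumes "n \<ge> 1" and "length k = n" and "\<forall>x\<in>set k. x > 0" and "K = sum_list k"
  shows
    "(\<exists>P Q :: rat poly.
        (\<forall>m. stirling_B k m = poly P (of_nat m)) \<and> (\<forall>m. stirling_b k m = poly Q (of_nat m)) \<and>
        degree P = K \<and> degree Q = K \<and>
        lead_coeff P = of_nat (card (stirling_perms k)) / fact K \<and>
        lead_coeff Q = of_nat (card (stirling_perms k)) / fact K \<and>
        (\<forall>j\<le>K - n. poly P (- of_nat j) = 0) \<and>
        P = smult ((-1) ^ K) (pcompose Q [:0, -1:]))
   \<and> (last k > 1 \<longrightarrow> (\<forall>m\<ge>1.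
        stirling_B k m = (\<Sum>i = 0..m. of_nat i * stirling_B (butlast k) i
                   * of_nat ((last k + m - i - 2) choose (last k - 2))) \<and>
        stirling_b k m = (\<Sum>i = 0..m - 1. of_nat i * stirling_b (butlast k) i
                   * of_nat ((m - i - 1) choose (last k - 2)))))
   \<and> ((\<forall>m. stirling_B [] m = 1) \<and> stirling_B k 0 = 0 \<and>
      (\<forall>m\<ge>1. (last k > 1 \<longrightarrow> stirling_B k m = stirling_B k (m - 1) + stirling_B (dec_last k) m) \<and>
              (last k = 1 \<longrightarrow> stirling_B k m = of_nat m * stirling_B (dec_last k) m)))
   \<and> ((\<forall>m. stirling_b [] m = 1) \<and> stirling_b k 0 = 0 \<and>
      (\<forall>m\<ge>1. (last k > 1 \<longrightarrow> stirling_b k m = stirling_b k (m - 1) + stirling_b (dec_last k) (m - 1)) \<and>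
              (last k = 1 \<longrightarrow> stirling_b k m = of_nat m * stirling_b (dec_last k) m)))"
proof -
  note pos = assms(3)
  obtain k0 a where k: "k = k0 @ [a]"
    using assms(1,2) by (cases k rule: rev_cases) auto
  have pos0: "\<forall>x\<in>set k0. 0 < x"
    using pos by (simp add: k)
  have ne: "k \<noteq> []" by (simp add: k)
  let ?P = "stirling_poly k"
  \<comment> \<open>Reciprocity taken as the definition of the second polynomial; the map is an
    involution, so it also yields the required expression of \<open>?P\<close> through
    \<open>?Q\<close>.\<close>
  let ?Q = "smult ((-1) ^ K) (pcompose ?P [:0, -1:])"
  have sign: "(-1) ^ K * (-1) ^ K = (1 :: rat)"
    by (simp flip: power_mult_distrib)
  have P: "\<forall>m. stirling_B k m = poly ?P (of_nat m)"
    by (simp add: poly_stirling_poly stirling_B_eq_stirling_fn[OF pos])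
  have Q: "\<forall>m. stirling_b k m = poly ?Q (of_nat m)"
    by (simp add: poly_pcompose poly_stirling_poly stirling_b_eq_stirling_fn[OF pos] assms(4))
  have degP: "degree ?P = K"
    using degree_stirling_poly[OF pos] assms(4) by simp
  have degQ: "degree ?Q = K"
    by (simp add: degree_pcompose degP)
  have leadP: "lead_coeff ?P = of_nat (card (stirling_perms k)) / fact K"
    unfolding degP using coeff_stirling_poly[of k] assms(4) by simp
  \<comment> \<open>The substitution of \<open>-x\<close> in degree \<open>K\<close> contributes a
    second sign, which cancels the first.\<close>
  have "lead_coeff ?Q = (-1) ^ K * (lead_coeff ?P * (-1) ^ K)"
    using lead_coeff_comp[of "[:0, -1:]" ?P] by (simp add: lead_coeff_smult degP)
  then have leadQ: "lead_coeff ?Q = of_nat (card (stirling_perms k)) / fact K"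
    using sign leadP by (simp add: mult.left_commute)
  have PQ: "?P = smult ((-1) ^ K) (pcompose ?Q [:0, -1:])"
    by (simp add: pcompose_smult sign pcompose_pCons flip: pcompose_assoc)
  have zeros: "\<forall>j\<le>K - n. poly ?P (- of_nat j) = 0"
    using stirling_fn_eq_0[OF pos ne] assms(2,4) by (simp add: poly_stirling_poly)
  have part2: "stirling_B k m = (\<Sum>i = 0..m. of_nat i * stirling_B (butlast k) i
                   * of_nat ((last k + m - i - 2) choose (last k - 2)))"
    "stirling_b k m = (\<Sum>i = 0..m - 1. of_nat i * stirling_b (butlast k) i
                   * of_nat ((m - i - 1) choose (last k - 2)))" if "1 < last k" "1 \<le> m" for m
  proof -
    have "{0..m - 1} = {..<m}" using that(2) by auto
    then show "stirling_B k m = (\<Sum>i = 0..m. of_nat i * stirling_B (butlast k) i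
                   * of_nat ((last k + m - i - 2) choose (last k - 2)))"
      "stirling_b k m = (\<Sum>i = 0..m - 1. of_nat i * stirling_b (butlast k) i
                   * of_nat ((m - i - 1) choose (last k - 2)))"
      using that(1) stirling_B_snoc_convolution[OF pos0, of a m]
        stirling_b_snoc_convolution[OF pos0, of a m] by (simp_all add: k)
  qed
  have rec1: "stirling_B k m = of_nat m * stirling_B (dec_last k) m"
    "stirling_b k m = of_nat m * stirling_b (dec_last k) m" if "last k = 1" for m
    using that stirling_B_snoc_1[OF pos0, of m] stirling_b_snoc_1[OF pos0, of m]
    by (simp_all add: k dec_last_def)
  have recSuc: "stirling_B k m = stirling_B k (m - 1) + stirling_B (dec_last k) m"
    "stirling_b k m = stirling_b k (m - 1) + stirling_b (dec_last k) (m - 1)"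
    if "1 < last k" "1 \<le> m" for m
  proof -
    \<comment> \<open>Since \<open>a > 1\<close>, \<open>dec_last\<close> lowers the last entry
      without deleting it.\<close>
    have "0 < a - 1" "Suc (a - 1) = a" "Suc (m - 1) = m" "dec_last k = k0 @ [a - 1]"
      using that by (auto simp: k dec_last_def)
    then show "stirling_B k m = stirling_B k (m - 1) + stirling_B (dec_last k) m"
      "stirling_b k m = stirling_b k (m - 1) + stirling_b (dec_last k) (m - 1)"
      using stirling_B_snoc_Suc[OF pos0, of "a - 1" "m - 1"]
        stirling_b_snoc_Suc[OF pos0, of "a - 1" "m - 1"] by (simp_all add: k)
  qed
  have part1: "\<exists>P Q :: rat poly.
        (\<forall>m. stirling_B k m = poly P (of_nat m)) \<and> (\<forall>m. stirling_b k m = poly Q (of_nat m)) \<and>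
        degree P = K \<and> degree Q = K \<and>
        lead_coeff P = of_nat (card (stirling_perms k)) / fact K \<and>
        lead_coeff Q = of_nat (card (stirling_perms k)) / fact K \<and>
        (\<forall>j\<le>K - n. poly P (- of_nat j) = 0) \<and>
        P = smult ((-1) ^ K) (pcompose Q [:0, -1:])"
    by (rule exI[of _ ?P], rule exI[of _ ?Q])
       (intro conjI P Q degP degQ leadP leadQ zeros PQ)
  have empty: "stirling_B [] m = 1" "stirling_b [] m = 1" for m
    by (simp_all add: stirling_B_def stirling_b_def)
  show ?thesis
    by (intro conjI impI allI)
       (rule part1 part2 rec1 recSuc empty stirling_B_0[OF pos ne] stirling_b_0[OF pos ne]; assumption)+
qed

end
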